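(* Let $k$ be a field and let $R=\bigoplus_{i\ge 0}R_i$ be a positively graded Noetherian $k$-algebra with $R_0=k$ and irrelevant ideal $\mathfrak{m}=\bigoplus_{i\ge 1}R_i$. Suppose $x_1,\dots,x_n\in\mathfrak{m}$ are homogeneous elements such that $R=k[x_1,\dots,x_n]$. Let $$a=\min\{\deg(x_i)\}_{i=1}^n\le b=\max\{\deg(x_i)\}_{i=1}^n.$$ Then $$a\,\mathrm{g}\ell\ell(R)-(a-1)^2\le \mathbf{ggl}(R)\le b\,\mathrm{g}\ell\ell(R)-b+1.$$ If $a=b=1$, then $\mathbf{ggl}(R)=\mathrm{g}\ell\ell(R)$.
   Context: For $n\ge 0$ put $\mathfrak{m}_n=\bigoplus_{i\ge n}R_i$. The generalized graded length $\mathbf{ggl}(R)$ is the smallest positive integer $n$ for which $\mathfrak{m}_n$ is contained in the ideal generated by some homogeneous system of parameters of $R$. In this graded setting, the generalized Loewy length $\mathrm{g}\ell\ell(R)$ is the smallest positive integer $n$ for which the power $\mathfrak{m}^n$ is contained in the ideal generated by some homogeneous system of parameters of $R$. *)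

theory Defs
  imports "HOL-Algebra.Algebra" "HOL-Library.Extended_Real"
begin

text \<open>
  A positively graded Noetherian \<open>K\<close>-algebra: \<open>G i\<close> is the component of degree \<open>i\<close>, and the
  field \<open>K = G 0\<close> is regarded as a subset of \<open>R\<close>. The components are \<open>K\<close>-subspaces because
  \<open>graded_mult\<close> with \<open>i = 0\<close> makes them closed under multiplication by \<open>K\<close>.
\<close>

locale positively_graded_noetherian_algebra = cring R + noetherian_ring R
  for R (structure) +
  fixes K :: "'a set" and G :: "nat \<Rightarrow> 'a set"
  assumes subfield_K: "subfield K R"
    and component_0: "G 0 = K"
    and component_subgroup: "additive_subgroup (G i) R"
    and graded_mult: "\<lbrakk>x \<in> G i; y \<in> G j\<rbrakk> \<Longrightarrow> x \<otimes> y \<in> G (i + j)"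
    and direct_sum: "x \<in> carrier R \<Longrightarrow>
      \<exists>!f. (\<forall>i. f i \<in> G i) \<and> finite {i. f i \<noteq> \<zero>} \<and> x = (\<Oplus>i\<in>{i. f i \<noteq> \<zero>}. f i)"

definition graded_tail :: "('a, 'm) ring_scheme \<Rightarrow> (nat \<Rightarrow> 'a set) \<Rightarrow> nat \<Rightarrow> 'a set" where
  "graded_tail R G n = {(\<Oplus>\<^bsub>R\<^esub>i\<in>{n..N}. f i) | f N. \<forall>i. f i \<in> G i}"

abbreviation irrelevant_ideal :: "('a, 'm) ring_scheme \<Rightarrow> (nat \<Rightarrow> 'a set) \<Rightarrow> 'a set" where
  "irrelevant_ideal R G \<equiv> graded_tail R G 1"

text \<open>
  The supremum of the lengths \<open>n\<close> of chains of primes \<open>P 0 \<subset> \<dots> \<subset> P n\<close>.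
  The zero ring, which has no primes, gets dimension \<open>0\<close>; it does not occur below, because ideals
  generated by homogeneous elements of positive degree are proper.
\<close>

definition krull_dim :: "('a, 'm) ring_scheme \<Rightarrow> enat" where
  "krull_dim R = Sup {enat n | n.
     \<exists>P. (\<forall>i\<le>n. primeideal (P i) R) \<and> (\<forall>i<n. P i \<subset> P (Suc i))}"

definition homogeneous_sop :: "('a, 'm) ring_scheme \<Rightarrow> (nat \<Rightarrow> 'a set) \<Rightarrow> 'a list \<Rightarrow> bool" where
  "homogeneous_sop R G ys \<longleftrightarrow>
     enat (length ys) = krull_dim R \<and>
     (\<forall>y\<in>set ys. \<exists>i\<ge>1. y \<in> G i) \<and>
     krull_dim (R Quot (Idl\<^bsub>R\<^esub> (set ys))) = 0"

text \<open>
  The infimum in \<^typ>\<open>enat\<close> of a nonempty set is its least element. The sets below are nonempty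
  because homogeneous systems of parameters exist; the convention that an empty infimum is
  \<open>\<infinity>\<close> only makes the definitions total.
\<close>

definition ggl :: "('a, 'm) ring_scheme \<Rightarrow> (nat \<Rightarrow> 'a set) \<Rightarrow> enat" where
  "ggl R G = Inf {enat n | n. n \<ge> 1 \<and>
     (\<exists>ys. homogeneous_sop R G ys \<and> graded_tail R G n \<subseteq> Idl\<^bsub>R\<^esub> (set ys))}"

definition gll :: "('a, 'm) ring_scheme \<Rightarrow> (nat \<Rightarrow> 'a set) \<Rightarrow> enat" where
  "gll R G = Inf {enat n | n. n \<ge> 1 \<and>
     (\<exists>ys. homogeneous_sop R G ys \<and>
        irrelevant_ideal R G [^]\<^bsub>ideals_set R\<^esub> n \<subseteq> Idl\<^bsub>R\<^esub> (set ys))}"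

end

theory Submission
  imports Defs
begin

text \<open>
  Both lengths ask when one of two filtrations of \<open>R\<close>, by the tails \<open>graded_tail R G n\<close> or by the
  powers of the irrelevant ideal \<open>m\<close>, enters the ideal of a homogeneous system of parameters. It
  therefore suffices to compare the filtrations: an ideal that contains a step of one of them
  contains a corresponding step of the other.

  A homogeneous element of degree \<open>i\<close> is a combination of monomials of degree \<open>i\<close> in the
  generators. Since each generator has degree at most \<open>b\<close>, such a monomial has at least \<open>i / b\<close>
  factors, so the tail from degree \<open>b * (g - 1) + 1\<close> on lies in the \<open>g\<close>-th power of \<open>m\<close>
  (\<open>graded_tail_subset_irrelevant_power\<close>); this gives the upper bound. Since each generator has
  degree at least \<open>a\<close>, the ideal \<open>m\<close> lives in degrees at least \<open>a\<close>, so its \<open>q\<close>-th power lies in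
  degrees at least \<open>a * q\<close> (\<open>irrelevant_power_subset_graded_tail\<close>). With \<open>q\<close> the rounding up of
  \<open>ggl / a\<close> this yields \<open>a * gll \<le> ggl + (a - 1)\<close>, and \<open>a - 1 \<le> (a - 1)\<^sup>2\<close>.

  The arguments with monomials are made rigorous by
  \<open>graded_subring_containing_generators\<close>: a multiplicative family of subgroups of the components
  that contains \<open>K\<close> and the generators consists of the full components. It is applied once to the
  family of homogeneous elements in suitable powers of \<open>m\<close>, and once to the family that is zero in
  degrees between \<open>0\<close> and \<open>a\<close>.

  If one length is infinite then so is the other, by the same comparison.
\<close>

section \<open>Tails of a family of additive subgroups\<close>

lemma (in ring) additive_subgroup_of_closed:
  assumes "A \<subseteq> carrier R" "\<zero> \<in> A"
    and "\<And>u v. \<lbrakk>u \<in> A; v \<in> A\<rbrakk> \<Longrightarrow> u \<oplus> v \<in> A" "\<And>u. u \<in> A \<Longrightarrow> \<ominus> u \<in> A"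
  shows "additive_subgroup A R"
  by (intro additive_subgroupI subgroup.intro) (use assms in \<open>auto simp: a_inv_def\<close>)

lemma (in ring) additive_subgroup_Int:
  assumes "additive_subgroup A R" "additive_subgroup B R"
  shows "additive_subgroup (A \<inter> B) R"
proof -
  interpret A: additive_subgroup A R by fact
  interpret B: additive_subgroup B R by fact
  show ?thesis
    by (rule additive_subgroup_of_closed) (use A.a_subset in \<open>auto simp: a_inv_def[symmetric]\<close>)
qed

lemma (in ring) additive_subgroup_finsum_closed:
  assumes "additive_subgroup A R" "\<And>i. i \<in> I \<Longrightarrow> f i \<in> A"
  shows "(\<Oplus>i\<in>I. f i) \<in> A"
proof -
  interpret A: additive_subgroup A R by fact
  show ?thesis
    using assms(2) by (induction I rule: infinite_finite_induct) (auto simp: finsum_infinite Pi_def)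
qed

text \<open>
  Together with \<open>component_subset_graded_tail\<close> and \<open>graded_tail_additive_subgroup\<close>, this
  characterizes a tail as the least additive subgroup containing the later components. Inclusions
  out of a tail are proved by this property below, without handling sums.
\<close>

lemma (in ring) graded_tail_least:
  assumes "additive_subgroup A R" "\<And>i. i \<ge> n \<Longrightarrow> J i \<subseteq> A"
  shows "graded_tail R J n \<subseteq> A"
  unfolding graded_tail_def using assms by (fastforce intro: additive_subgroup_finsum_closed)

lemma (in ring) component_subset_graded_tail:
  assumes "\<And>i. additive_subgroup (J i) R" "i \<ge> n"
  shows "J i \<subseteq> graded_tail R J n"
proof
  fix z assume z: "z \<in> J i"
  interpret J: additive_subgroup "J j" R for j by (rule assms(1))
  have "(\<Oplus>j\<in>{n..i}. if i = j then z else \<zero>) = z"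
    using z assms(2) J.a_subset by (intro add.finprod_singleton) auto
  then show "z \<in> graded_tail R J n"
    unfolding graded_tail_def using z
    by (auto intro!: exI[of _ "\<lambda>j. if i = j then z else \<zero>"] exI[of _ i])
qed

text \<open>
  The upper bound of summation can be raised by padding with zeros, so two tail elements can be
  brought to a common range and added there.
\<close>

lemma (in ring) graded_tail_additive_subgroup:
  assumes J: "\<And>i. additive_subgroup (J i) R"
  shows "additive_subgroup (graded_tail R J n) R"
proof -
  interpret J: additive_subgroup "J j" R for j by (rule J)
  have pad: "\<exists>g. (\<forall>i. g i \<in> J i) \<and> (\<Oplus>i\<in>{n..N}. f i) = (\<Oplus>i\<in>{n..M}. g i)"
    if "\<forall>i. f i \<in> J i" "N \<le> M" for f N M
  proof -
    have "f i \<in> carrier R" for i using that(1) J.a_subset by blast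
    with that show ?thesis
      by (intro exI[of _ "\<lambda>i. if i \<le> N then f i else \<zero>"] conjI add.finprod_mono_neutral_cong_left) auto
  qed
  show ?thesis
  proof (rule additive_subgroup_of_closed)
    show "graded_tail R J n \<subseteq> carrier R"
      using J.a_subset by (auto simp: graded_tail_def Pi_def intro!: finsum_closed)
    show "\<zero> \<in> graded_tail R J n"
      using component_subset_graded_tail[of J n n, OF J] J.zero_closed[of n] by auto
  next
    fix u v assume "u \<in> graded_tail R J n" "v \<in> graded_tail R J n"
    then obtain f g N M where *: "\<forall>i. f i \<in> J i" "\<forall>i. g i \<in> J i"
      "u = (\<Oplus>i\<in>{n..N}. f i)" "v = (\<Oplus>i\<in>{n..M}. g i)"
      unfolding graded_tail_def by blast
    obtain f' g' where **: "\<forall>i. f' i \<in> J i" "\<forall>i. g' i \<in> J i"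
      "u = (\<Oplus>i\<in>{n..max N M}. f' i)" "v = (\<Oplus>i\<in>{n..max N M}. g' i)"
      using pad[OF *(1), of N "max N M"] pad[OF *(2), of M "max N M"] *(3,4) by auto
    have "u \<oplus> v = (\<Oplus>i\<in>{n..max N M}. f' i \<oplus> g' i)"
      unfolding **(3,4) using **(1,2) J.a_subset by (intro finsum_addf[symmetric]) auto
    then show "u \<oplus> v \<in> graded_tail R J n"
      unfolding graded_tail_def using **(1,2) by (auto intro!: exI[of _ "\<lambda>i. f' i \<oplus> g' i"])
  next
    fix u assume "u \<in> graded_tail R J n"
    then obtain f N where *: "\<forall>i. f i \<in> J i" "u = (\<Oplus>i\<in>{n..N}. f i)"
      unfolding graded_tail_def by blast
    have fc: "f i \<in> carrier R" for i using * J.a_subset by auto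
    have "(\<Oplus>i\<in>{n..N}. f i) \<oplus> (\<Oplus>i\<in>{n..N}. \<ominus> f i) = (\<Oplus>i\<in>{n..N}. f i \<oplus> \<ominus> f i)"
      using fc by (intro finsum_addf[symmetric]) auto
    also have "\<dots> = \<zero>" using fc by (simp add: r_neg)
    finally have "\<ominus> u = (\<Oplus>i\<in>{n..N}. \<ominus> f i)"
      using fc *(2) by (metis (no_types, lifting) Pi_I a_inv_closed add.m_comm finsum_closed minus_equality)
    then show "\<ominus> u \<in> graded_tail R J n"
      unfolding graded_tail_def using *(1) by (auto intro!: exI[of _ "\<lambda>i. \<ominus> f i"])
  qed
qed

lemma (in ring) additive_subgroup_vimage_mult:
  assumes "additive_subgroup A R" "u \<in> carrier R"
  shows "additive_subgroup {v \<in> carrier R. u \<otimes> v \<in> A} R"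
proof -
  interpret A: additive_subgroup A R by fact
  show ?thesis
    by (rule additive_subgroup_of_closed) (use assms(2) in \<open>auto simp: r_distr r_minus\<close>)
qed

text \<open>
  Leastness of the tails is used once per factor: for homogeneous \<open>w\<close> the elements \<open>v\<close> with
  \<open>w \<otimes> v\<close> in the target form an additive subgroup, which contains a whole tail as soon as it
  contains the later components; then the roles of the factors are exchanged.
\<close>

lemma (in cring) graded_tail_mult:
  assumes J: "\<And>i. additive_subgroup (J i) R"
    and mult: "\<And>i j u v. \<lbrakk>u \<in> J i; v \<in> J j\<rbrakk> \<Longrightarrow> u \<otimes> v \<in> J (i + j)"
    and u: "u \<in> graded_tail R J s" and v: "v \<in> graded_tail R J t"
  shows "u \<otimes> v \<in> graded_tail R J (s + t)"
proof -
  interpret J: additive_subgroup "J j" R for j by (rule J)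
  interpret T: additive_subgroup "graded_tail R J j" R for j
    by (rule graded_tail_additive_subgroup[OF J])
  have hom: "w \<otimes> v \<in> graded_tail R J (s + t)" if w: "w \<in> J i" "i \<ge> s" for w i
  proof -
    have "graded_tail R J t \<subseteq> {v \<in> carrier R. w \<otimes> v \<in> graded_tail R J (s + t)}"
    proof (intro graded_tail_least additive_subgroup_vimage_mult T.is_additive_subgroup subsetI)
      show "w \<in> carrier R" using w J.a_subset by auto
    next
      fix j v assume "t \<le> j" "v \<in> J j"
      with w mult[of w i v j] component_subset_graded_tail[of J "s + t" "i + j", OF J]
      show "v \<in> {v \<in> carrier R. w \<otimes> v \<in> graded_tail R J (s + t)}"
        using J.a_subset by auto
    qed
    with v show ?thesis by auto
  qed
  have vc: "v \<in> carrier R" using v T.a_subset by auto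
  have "graded_tail R J s \<subseteq> {w \<in> carrier R. v \<otimes> w \<in> graded_tail R J (s + t)}"
  proof (intro graded_tail_least additive_subgroup_vimage_mult T.is_additive_subgroup vc subsetI)
    fix i w assume "s \<le> i" "w \<in> J i"
    then show "w \<in> {w \<in> carrier R. v \<otimes> w \<in> graded_tail R J (s + t)}"
      using hom[of w i] vc J.a_subset[of i] by (auto simp: m_comm)
  qed
  moreover have "u \<in> carrier R" using u T.a_subset by auto
  ultimately show ?thesis using u vc by (auto simp: m_comm)
qed

section \<open>Graded subrings containing the generators\<close>

context positively_graded_noetherian_algebra
begin

lemmas tail_subgroup = graded_tail_additive_subgroup[of G, OF component_subgroup]
lemmas component_subset_tail = component_subset_graded_tail[of G, OF component_subgroup]

lemma tail_mult:
  "\<lbrakk>u \<in> graded_tail R G s; v \<in> graded_tail R G t\<rbrakk> \<Longrightarrow> u \<otimes> v \<in> graded_tail R G (s + t)"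
  by (rule graded_tail_mult[of G]) (rule component_subgroup graded_mult | assumption)+

lemma graded_tail_0: "graded_tail R G 0 = carrier R"
proof
  show "graded_tail R G 0 \<subseteq> carrier R"
    by (rule additive_subgroup.a_subset[OF tail_subgroup])
next
  interpret T: additive_subgroup "graded_tail R G 0" R
    by (rule tail_subgroup)
  show "carrier R \<subseteq> graded_tail R G 0"
  proof
    fix z assume "z \<in> carrier R"
    then obtain f where f: "\<forall>i. f i \<in> G i" "z = (\<Oplus>i\<in>{i. f i \<noteq> \<zero>}. f i)"
      using direct_sum by blast
    have "f i \<in> graded_tail R G 0" for i
      using f(1) component_subset_tail[of 0 i] by auto
    then show "z \<in> graded_tail R G 0"
      unfolding f(2) by (intro additive_subgroup_finsum_closed T.is_additive_subgroup)
  qed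
qed

text \<open>
  Besides a decomposition into elements of the \<open>J j\<close>, a homogeneous \<open>z\<close> has the decomposition whose
  only term is \<open>z\<close>, and the two agree because homogeneous decompositions are unique.
\<close>

lemma homogeneous_element_of_subfamily:
  assumes J: "\<And>i. additive_subgroup (J i) R" and sub: "\<And>i. J i \<subseteq> G i"
    and z: "z \<in> G i" "z \<in> graded_tail R J 0"
  shows "z \<in> J i"
proof -
  interpret J: additive_subgroup "J j" R for j by (rule J)
  interpret G: additive_subgroup "G j" R for j by (rule component_subgroup)
  obtain f N where f: "\<forall>j. f j \<in> J j" "z = (\<Oplus>j\<in>{0..N}. f j)"
    using z(2) unfolding graded_tail_def by blast
  define h where "h j = (if j \<le> N then f j else \<zero>)" for j
  define e where "e j = (if i = j then z else \<zero>)" for j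
  have fc: "f j \<in> carrier R" for j using f J.a_subset by blast
  have zc: "z \<in> carrier R" using z G.a_subset by blast
  have hJ: "h j \<in> J j" for j unfolding h_def using f by auto
  have "finite {j. h j \<noteq> \<zero>}"
    by (rule finite_subset[of _ "{0..N}"]) (auto simp: h_def)
  moreover have "z = (\<Oplus>j\<in>{j. h j \<noteq> \<zero>}. h j)"
    unfolding f(2) using fc
    by (intro add.finprod_mono_neutral_cong_right) (auto simp: h_def split: if_splits)
  moreover have "finite {j. e j \<noteq> \<zero>}"
    by (rule finite_subset[of _ "{i}"]) (auto simp: e_def)
  moreover have "z = (\<Oplus>j\<in>{j. e j \<noteq> \<zero>}. e j)"
  proof -
    have "(\<Oplus>j\<in>{j. e j \<noteq> \<zero>}. e j) = (\<Oplus>j\<in>{i}. e j)"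
      using zc by (intro add.finprod_mono_neutral_cong_left) (auto simp: e_def)
    then show ?thesis using zc by (simp add: e_def)
  qed
  moreover have "\<forall>j. h j \<in> G j" "\<forall>j. e j \<in> G j"
    using hJ sub z by (auto simp: e_def)
  ultimately have "h = e" using direct_sum[OF zc] by blast
  then show ?thesis using hJ[of i] by (simp add: e_def)
qed

text \<open>
  The sum of the \<open>J i\<close> is a subring that contains the generators, hence the whole ring; comparing
  homogeneous components then gives equality degree by degree.
\<close>

lemma graded_subring_containing_generators:
  assumes J: "\<And>i. additive_subgroup (J i) R" and sub: "\<And>i. J i \<subseteq> G i"
    and mult: "\<And>i j u v. \<lbrakk>u \<in> J i; v \<in> J j\<rbrakk> \<Longrightarrow> u \<otimes> v \<in> J (i + j)"
    and K: "K \<subseteq> J 0" and S: "S \<subseteq> (\<Union>i. J i)"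
    and gen: "generate_ring R (K \<union> S) = carrier R"
  shows "J i = G i"
proof
  interpret T: additive_subgroup "graded_tail R J 0" R
    by (rule graded_tail_additive_subgroup[OF J])
  have incl: "J i \<subseteq> graded_tail R J 0" for i
    by (rule component_subset_graded_tail[OF J]) simp
  have "subring (graded_tail R J 0) R"
  proof (rule subringI[OF T.a_subset])
    show "\<one> \<in> graded_tail R J 0"
      using subringE(3)[OF subfieldE(1)[OF subfield_K]] K incl by blast
    show "\<ominus> u \<in> graded_tail R J 0" if "u \<in> graded_tail R J 0" for u
      using T.a_inv_closed[OF that] by (simp add: a_inv_def)
    show "u \<otimes> v \<in> graded_tail R J 0" if "u \<in> graded_tail R J 0" "v \<in> graded_tail R J 0" for u v
      using graded_tail_mult[OF J mult that] by simp
  qed auto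
  moreover have "K \<union> S \<subseteq> graded_tail R J 0" using K S incl by blast
  ultimately have "carrier R \<subseteq> graded_tail R J 0"
    using generate_ring_min_subring1[of "K \<union> S"] gen T.a_subset by blast
  moreover have "G i \<subseteq> carrier R"
    using additive_subgroup.a_subset[OF component_subgroup] .
  ultimately show "G i \<subseteq> J i"
    using homogeneous_element_of_subfamily[OF J sub] by blast
qed (rule sub)

section \<open>Powers of the irrelevant ideal\<close>

lemma irrelevant_ideal_is_ideal: "ideal (irrelevant_ideal R G) R"
proof (rule idealI[OF ring_axioms])
  show "subgroup (irrelevant_ideal R G) (add_monoid R)"
    by (rule additive_subgroup.a_subgroup[OF tail_subgroup])
  fix u z assume "u \<in> irrelevant_ideal R G" "z \<in> carrier R"
  then show "z \<otimes> u \<in> irrelevant_ideal R G" "u \<otimes> z \<in> irrelevant_ideal R G"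
    using tail_mult[of z 0 u 1] tail_mult[of u 1 z 0]
    by (auto simp: graded_tail_0)
qed

abbreviation irrelevant_power :: "nat \<Rightarrow> 'a set" where
  "irrelevant_power p \<equiv> irrelevant_ideal R G [^]\<^bsub>ideals_set R\<^esub> p"

lemma irrelevant_power_ideal: "ideal (irrelevant_power p) R"
proof -
  interpret I: comm_monoid "ideals_set R" by (rule ideals_set_is_comm_monoid)
  show ?thesis
    using I.nat_pow_closed[of "irrelevant_ideal R G" p] irrelevant_ideal_is_ideal
    by (simp add: ideals_set_def)
qed

lemma irrelevant_power_0: "irrelevant_power 0 = carrier R"
  by (simp add: ideals_set_def)

lemma irrelevant_power_Suc:
  "irrelevant_power (Suc p) = irrelevant_power p \<cdot> irrelevant_ideal R G"
  by (simp add: ideals_set_def)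

lemma irrelevant_power_1: "irrelevant_power 1 = irrelevant_ideal R G"
  using irrelevant_power_Suc[of 0] irrelevant_power_0 irrelevant_ideal_is_ideal
    ideal_prod_commute[OF oneideal irrelevant_ideal_is_ideal] ideal_prod_one by simp

lemma irrelevant_power_add:
  "irrelevant_power (p + q) = irrelevant_power p \<cdot> irrelevant_power q"
proof -
  interpret I: comm_monoid "ideals_set R" by (rule ideals_set_is_comm_monoid)
  show ?thesis
    using I.nat_pow_mult[of "irrelevant_ideal R G" p q] irrelevant_ideal_is_ideal
    by (simp add: ideals_set_def)
qed

lemma irrelevant_power_antimono:
  assumes "p \<le> q"
  shows "irrelevant_power q \<subseteq> irrelevant_power p"
  using ideal_prod_inter[OF irrelevant_power_ideal irrelevant_power_ideal, of p "q - p"]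
    irrelevant_power_add[of p "q - p"] assms by simp

text \<open>
  A monomial of degree \<open>i\<close> in generators of degree at most \<open>b\<close> has at least \<open>i / b\<close> factors. The
  rounding up of \<open>i / b\<close> is subadditive in \<open>i\<close>, which makes the family below multiplicative.
\<close>

lemma component_subset_irrelevant_power:
  assumes S: "S \<subseteq> (\<Union>i\<in>{1..b}. G i)"
    and b: "b \<ge> 1" and gen: "generate_ring R (K \<union> S) = carrier R"
  shows "G i \<subseteq> irrelevant_power ((i + b - 1) div b)"
proof -
  \<comment> \<open>\<open>c j\<close> is \<open>j / b\<close> rounded up.\<close>
  define c where "c j = (j + b - 1) div b" for j
  define J where "J j = G j \<inter> irrelevant_power (c j)" for j
  have c_le_iff: "c j \<le> p \<longleftrightarrow> j \<le> b * p" for j p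
  proof -
    have "c j < Suc p \<longleftrightarrow> j + b - 1 < Suc p * b"
      unfolding c_def using b by (intro div_less_iff_less_mult) simp
    also have "\<dots> \<longleftrightarrow> j \<le> b * p" using b by (auto simp: mult.commute)
    finally show ?thesis by auto
  qed
  have c_add: "c (j + l) \<le> c j + c l" for j l
    using c_le_iff[of j "c j"] c_le_iff[of l "c l"] by (simp add: c_le_iff distrib_left)
  interpret P: ideal "irrelevant_power p" R for p by (rule irrelevant_power_ideal)
  interpret G: additive_subgroup "G j" R for j by (rule component_subgroup)
  have "J i = G i"
  proof (rule graded_subring_containing_generators[OF _ _ _ _ _ gen])
    fix j show "additive_subgroup (J j) R"
      unfolding J_def by (intro additive_subgroup_Int G.is_additive_subgroup P.is_additive_subgroup)
    show "J j \<subseteq> G j" unfolding J_def by auto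
  next
    fix j l u v assume "u \<in> J j" "v \<in> J l"
    then have uv: "u \<in> G j" "v \<in> G l" "u \<in> irrelevant_power (c j)" "v \<in> irrelevant_power (c l)"
      by (auto simp: J_def)
    have "u \<otimes> v \<in> G (j + l)" using uv by (intro graded_mult)
    moreover have "u \<otimes> v \<in> irrelevant_power (c j + c l)"
      unfolding irrelevant_power_add using uv by (intro ideal_prod.prod)
    ultimately show "u \<otimes> v \<in> J (j + l)"
      using irrelevant_power_antimono[OF c_add] by (auto simp: J_def)
  next
    have "c 0 = 0" using c_le_iff[of 0 0] by simp
    then show "K \<subseteq> J 0"
      using irrelevant_power_0 component_0 G.a_subset[of 0] by (auto simp: J_def)
  next
    show "S \<subseteq> (\<Union>j. J j)"
    proof
      fix y assume "y \<in> S"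
      then obtain j where j: "1 \<le> j" "j \<le> b" "y \<in> G j" using S by force
      then have "y \<in> irrelevant_power 1"
        using component_subset_tail[of 1 j] irrelevant_power_1 by auto
      moreover have "c j \<le> 1" using j by (simp add: c_le_iff)
      ultimately show "y \<in> (\<Union>j. J j)"
        using j irrelevant_power_antimono[of "c j" 1] by (auto simp: J_def simp del: One_nat_def)
    qed
  qed
  then show ?thesis by (auto simp: J_def c_def)
qed

lemma graded_tail_subset_irrelevant_power:
  assumes S: "S \<subseteq> (\<Union>i\<in>{1..b}. G i)"
    and b: "b \<ge> 1" and gen: "generate_ring R (K \<union> S) = carrier R"
  shows "graded_tail R G (b * p + 1) \<subseteq> irrelevant_power (Suc p)"
proof (rule graded_tail_least)
  show "additive_subgroup (irrelevant_power (Suc p)) R"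
    using irrelevant_power_ideal ideal.axioms(1) by blast
  fix i assume "b * p + 1 \<le> i"
  then have "Suc p * b \<le> i + b - 1" using b by (simp add: mult.commute)
  then have "Suc p \<le> (i + b - 1) div b" using b by (simp add: less_eq_div_iff_mult_less_eq)
  then show "G i \<subseteq> irrelevant_power (Suc p)"
    using component_subset_irrelevant_power[OF assms] irrelevant_power_antimono by blast
qed

text \<open>
  A nonempty monomial has degree at least \<open>a\<close>. In terms of the family below: a product whose degree
  lies strictly between \<open>0\<close> and \<open>a\<close> has a factor whose degree does, so the family is multiplicative.
\<close>

lemma component_eq_zero:
  assumes S: "S \<subseteq> (\<Union>i\<in>{a..}. G i)"
    and gen: "generate_ring R (K \<union> S) = carrier R" and i: "0 < i" "i < a"
  shows "G i = {\<zero>}"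
proof -
  define J where "J j = (if 0 < j \<and> j < a then {\<zero>} else G j)" for j
  interpret G: additive_subgroup "G j" R for j by (rule component_subgroup)
  have carr: "u \<in> G j \<Longrightarrow> u \<in> carrier R" for u j using G.a_subset by blast
  have "J i = G i"
  proof (rule graded_subring_containing_generators[OF _ _ _ _ _ gen])
    fix j show "additive_subgroup (J j) R"
      unfolding J_def by (auto simp: component_subgroup intro!: additive_subgroup_of_closed)
    show "J j \<subseteq> G j" unfolding J_def by auto
  next
    fix j l u v assume uv: "u \<in> J j" "v \<in> J l"
    have JG: "J j \<subseteq> G j" for j unfolding J_def by auto
    show "u \<otimes> v \<in> J (j + l)"
    proof (cases "0 < j + l \<and> j + l < a")
      case True
      then have "u = \<zero> \<or> v = \<zero>" using uv by (auto simp: J_def split: if_splits)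
      then show ?thesis using True uv JG carr by (auto simp: J_def split: if_splits)
    next
      case False
      then show ?thesis using graded_mult[of u j v l] uv JG unfolding J_def[of "j + l"] by auto
    qed
  next
    show "K \<subseteq> J 0" using component_0 by (simp add: J_def)
  next
    have "G j = J j" if "a \<le> j" for j using that by (simp add: J_def)
    then show "S \<subseteq> (\<Union>j. J j)" using S by fastforce
  qed
  then show ?thesis using i by (simp add: J_def)
qed

lemma irrelevant_power_subset_graded_tail:
  assumes S: "S \<subseteq> (\<Union>i\<in>{a..}. G i)"
    and gen: "generate_ring R (K \<union> S) = carrier R"
  shows "irrelevant_power p \<subseteq> graded_tail R G (a * p)"
proof (induction p)
  case 0
  then show ?case by (simp only: irrelevant_power_0 graded_tail_0 mult_0_right)
next
  case (Suc p)
  interpret T: additive_subgroup "graded_tail R G j" R for j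
    by (rule tail_subgroup)
  have m: "irrelevant_ideal R G \<subseteq> graded_tail R G a"
  proof (intro graded_tail_least T.is_additive_subgroup)
    fix i :: nat assume "1 \<le> i"
    then show "G i \<subseteq> graded_tail R G a"
      using component_eq_zero[OF S gen, of i] T.zero_closed[of a]
        component_subset_tail[of a i]
      by (cases "i < a") auto
  qed
  show ?case
  proof
    fix u assume "u \<in> irrelevant_power (Suc p)"
    then have "u \<in> irrelevant_power p \<cdot> irrelevant_ideal R G" by (simp only: irrelevant_power_Suc)
    then show "u \<in> graded_tail R G (a * Suc p)"
    proof induction
      case (prod u v)
      then have "u \<in> graded_tail R G (a * p)" "v \<in> graded_tail R G a" using Suc m by blast+
      from tail_mult[OF this]
      show ?case by (simp add: add.commute)
    qed simp
  qed
qed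

lemma graded_tail_antimono:
  assumes "s \<le> t"
  shows "graded_tail R G t \<subseteq> graded_tail R G s"
  using assms by (intro graded_tail_least tail_subgroup component_subset_tail) simp

end

section \<open>Comparison of the two lengths\<close>

lemma Inf_enat_attained:
  assumes "Inf {enat n | n. P n} = enat m"
  shows "P m"
proof -
  have "{enat n | n. P n} \<noteq> {}" using assms by (metis Inf_enat_def enat.distinct(1))
  then have "Inf {enat n | n. P n} \<in> {enat n | n. P n}"
    unfolding Inf_enat_def by (auto intro: LeastI)
  with assms show ?thesis by auto
qed

lemma (in positively_graded_noetherian_algebra) ggl_le:
  assumes S: "S \<subseteq> (\<Union>i\<in>{1..b}. G i)"
    and b: "b \<ge> 1" and gen: "generate_ring R (K \<union> S) = carrier R" and g: "gll R G = enat g"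
  shows "g \<ge> 1" "ggl R G \<le> enat (b * (g - 1) + 1)"
proof -
  obtain ys where ys: "g \<ge> 1" "homogeneous_sop R G ys" "irrelevant_power g \<subseteq> Idl (set ys)"
    using Inf_enat_attained[OF g[unfolded gll_def]] by blast
  then show "g \<ge> 1" by simp
  have "graded_tail R G (b * (g - 1) + 1) \<subseteq> Idl (set ys)"
    using graded_tail_subset_irrelevant_power[OF S b gen, of "g - 1"] ys by simp
  then show "ggl R G \<le> enat (b * (g - 1) + 1)"
    unfolding ggl_def using ys by (intro Inf_lower) auto
qed

lemma (in positively_graded_noetherian_algebra) gll_le:
  assumes S: "S \<subseteq> (\<Union>i\<in>{a..}. G i)"
    and a: "a \<ge> 1" and gen: "generate_ring R (K \<union> S) = carrier R" and p: "ggl R G = enat p"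
  shows "gll R G \<le> enat ((p + a - 1) div a)"
proof -
  let ?q = "(p + a - 1) div a"
  obtain ys where ys: "p \<ge> 1" "homogeneous_sop R G ys" "graded_tail R G p \<subseteq> Idl (set ys)"
    using Inf_enat_attained[OF p[unfolded ggl_def]] by blast
  have "p + a - 1 = a * ?q + (p + a - 1) mod a" by simp
  moreover have "(p + a - 1) mod a < a" using a by simp
  ultimately have "p \<le> a * ?q" by linarith
  then have "irrelevant_power ?q \<subseteq> Idl (set ys)"
    using irrelevant_power_subset_graded_tail[OF S gen, of ?q] graded_tail_antimono ys(3) by blast
  moreover have "?q \<ge> 1" using ys(1) a by (simp add: less_eq_div_iff_mult_less_eq)
  ultimately show ?thesis
    unfolding gll_def using ys by (intro Inf_lower) auto
qed

theorem proposition4p3: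
  fixes R :: "('a, 'm) ring_scheme" and K :: "'a set" and G :: "nat \<Rightarrow> 'a set"
    and x :: "nat \<Rightarrow> 'a" and d :: "nat \<Rightarrow> nat" and n a b :: nat
  assumes "positively_graded_noetherian_algebra R K G"
    and "n \<ge> 1"
    and "\<And>i. i \<in> {1..n} \<Longrightarrow> d i \<ge> 1 \<and> x i \<in> G (d i)"
    and "generate_ring R (K \<union> x ` {1..n}) = carrier R"
    and "a = Min (d ` {1..n})"
    and "b = Max (d ` {1..n})"
  shows "ereal (real a) * ereal_of_enat (gll R G) - ereal ((real a - 1)\<^sup>2) \<le> ereal_of_enat (ggl R G)
     \<and> ereal_of_enat (ggl R G) \<le> ereal (real b) * ereal_of_enat (gll R G) - ereal (real b) + 1
     \<and> (a = 1 \<and> b = 1 \<longrightarrow> ggl R G = gll R G)"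
proof -
  interpret positively_graded_noetherian_algebra R K G by fact
  let ?S = "x ` {1..n}"
  have ne: "d ` {1..n} \<noteq> {}" using assms(2) by auto
  have "a \<in> d ` {1..n}" unfolding assms(5) using ne by (intro Min_in) auto
  then have a: "a \<ge> 1" using assms(3) by auto
  have ab: "a \<le> d i" "d i \<le> b" if "i \<in> {1..n}" for i
    using that unfolding assms(5,6) by auto
  have b: "b \<ge> 1" using ab[of 1] a assms(2) by auto
  have Xa: "?S \<subseteq> (\<Union>i\<in>{a..}. G i)" and Xb: "?S \<subseteq> (\<Union>i\<in>{1..b}. G i)"
    using ab assms(3) by fastforce+
  note upper = ggl_le[OF Xb b assms(4)] and lower = gll_le[OF Xa a assms(4)]
  show ?thesis
  proof (cases "gll R G")
    case infinity
    then have "ggl R G = \<infinity>" using lower by (cases "ggl R G") auto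
    with infinity a b show ?thesis by simp
  next
    case (enat g)
    obtain p where p: "ggl R G = enat p" using upper[OF enat] by (cases "ggl R G") auto
    have g1: "g \<ge> 1" and pg: "p \<le> b * (g - 1) + 1" using upper[OF enat] p by auto
    have gp: "g \<le> (p + a - 1) div a" using lower[OF p] enat by simp
    then have "g * a \<le> p + a - 1" using a by (simp add: less_eq_div_iff_mult_less_eq)
    then have "a * g \<le> p + (a - 1)" using a by (simp add: mult.commute)
    then have "real a * real g \<le> real p + (real a - 1)"
      using a by (metis of_nat_1 of_nat_add of_nat_diff of_nat_le_iff of_nat_mult)
    \<comment> \<open>Rounding \<open>p / a\<close> up costs at most \<open>a - 1\<close>, which is at most its square since it is a natural number.\<close>
    moreover have "real a - 1 \<le> (real a - 1)\<^sup>2"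
      using a by (cases "a = 1") (auto simp: power2_eq_square)
    ultimately have L: "real a * real g - (real a - 1)\<^sup>2 \<le> real p" by linarith
    have "real p \<le> real (b * (g - 1) + 1)" using pg by (simp only: of_nat_le_iff)
    then have U: "real p \<le> real b * real g - real b + 1"
      using g1 by (simp add: of_nat_diff algebra_simps)
    have "a = 1 \<and> b = 1 \<longrightarrow> p = g" using gp pg g1 by auto
    with L U p enat show ?thesis by (simp add: one_ereal_def)
  qed
qed

end
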